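(* For any integer $n\geq 0$, there exists a (weight-preserving) bijection between $\mathcal{G}_n^{\mathbf{uvu}}(a,b,b^2)$ and $\mathcal{C}_{n}(a+b,b)$.
   Context: A G-Motzkin path of length $n$ is a lattice path from $(0,0)$ to $(n,0)$ in the first quadrant (never going below the $x$-axis) consisting of up steps $\mathbf{u}=(1,1)$, down steps $\mathbf{d}=(1,-1)$, horizontal steps $\mathbf{h}=(1,0)$ and vertical steps $\mathbf{v}=(0,-1)$. It is $\mathbf{uvu}$-avoiding if it contains no three consecutive steps $\mathbf{u},\mathbf{v},\mathbf{u}$. Here $a,b$ are commuting indeterminates. An $(a,b,c)$-G-Motzkin path is a G-Motzkin path in which each $\mathbf{u}$-, $\mathbf{h}$-, $\mathbf{v}$-, $\mathbf{d}$-step has weight $1,a,b,c$ respectively. $\mathcal{G}_n^{\mathbf{uvu}}(a,b,b^2)$ is the set of all $\mathbf{uvu}$-avoiding $(a,b,b^2)$-G-Motzkin paths of length $n$. A Dyck path of length $2n$ is a G-Motzkin path of length $2n$ with no $\mathbf{h}$-steps and no $\mathbf{v}$-steps. A $\mathbf{ud}$-peak is an occurrence of consecutive steps $\mathbf{u}\mathbf{d}$. An $(\alpha,\beta)$-Dyck path is a Dyck path in which $\mathbf{u}$-steps have weight $1$, the $\mathbf{d}$-steps in $\mathbf{ud}$-peaks have weight $\alpha$, and all other $\mathbf{d}$-steps have weight $\beta$; $\mathcal{C}_n(\alpha,\beta)$ is the set of $(\alpha,\beta)$-Dyck paths of length $2n$. Convention: in $\mathcal{C}_n(a+b,b)$,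 a $\mathbf{d}$-step of weight $a+b$ is regarded as coming in two kinds, $\mathbf{d}_a$ of weight $a$ and $\mathbf{d}_b$ of weight $b$; so an element of $\mathcal{C}_n(a+b,b)$ is a Dyck path of length $2n$ together with a choice, for each $\mathbf{ud}$-peak, of weight $a$ or $b$ for its $\mathbf{d}$-step, all other $\mathbf{d}$-steps having weight $b$. The weight of a path is the product of the weights of its steps; a bijection is weight-preserving if every path and its image have the same weight. *)

theory Defs
  imports
    "HOL-Library.FuncSet"
    "HOL-Library.Product_Plus"
    "HOL-Library.Sublist"
    "HOL-Computational_Algebra.Polynomial"
begin

datatype step = U | D | H | V

fun step_vec :: "step \<Rightarrow> int \<times> int" where
  "step_vec U = (1, 1)"
| "step_vec D = (1, -1)"
| "step_vec H = (1, 0)"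
| "step_vec V = (0, -1)"

text \<open>A lattice path starting at the origin is the list of its steps.\<close>

definition endpoint :: "step list \<Rightarrow> int \<times> int" where
  "endpoint p = (\<Sum>s\<leftarrow>p. step_vec s)"

text \<open>The length of a path is the abscissa of its endpoint. It differs from
  the number of steps as soon as the path has vertical steps.\<close>

definition g_motzkin_paths :: "nat \<Rightarrow> step list set" where
  "g_motzkin_paths n =
     {p. endpoint p = (int n, 0) \<and>
         (\<forall>k\<le>length p. 0 \<le> fst (endpoint (take k p)) \<and> 0 \<le> snd (endpoint (take k p)))}"

definition uvu_avoiding_paths :: "nat \<Rightarrow> step list set" where
  "uvu_avoiding_paths n = {p \<in> g_motzkin_paths n. \<not> sublist [U, V, U] p}"

fun step_weight :: "'r \<Rightarrow> 'r \<Rightarrow> 'r \<Rightarrow> step \<Rightarrow> 'r::comm_semiring_1" where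
  "step_weight a b c U = 1"
| "step_weight a b c H = a"
| "step_weight a b c V = b"
| "step_weight a b c D = c"

definition g_motzkin_weight :: "'r \<Rightarrow> 'r \<Rightarrow> 'r \<Rightarrow> step list \<Rightarrow> 'r::comm_semiring_1" where
  "g_motzkin_weight a b c p = (\<Prod>s\<leftarrow>p. step_weight a b c s)"

definition dyck_paths :: "nat \<Rightarrow> step list set" where
  "dyck_paths n = {p \<in> g_motzkin_paths (2 * n). H \<notin> set p \<and> V \<notin> set p}"

text \<open>A \<open>ud\<close>-peak is identified by the position of its down step.\<close>

definition peak_downs :: "step list \<Rightarrow> nat set" where
  "peak_downs p = {Suc i | i. Suc i < length p \<and> p ! i = U \<and> p ! Suc i = D}"

text \<open>The down steps in peaks get the weights \<open>\<alpha> i\<close>, which may depend on the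
  position \<open>i\<close>; for constant \<open>\<alpha>\<close> this is the weight of an
  \<open>(\<alpha>, \<beta>)\<close>-Dyck path.\<close>

definition dyck_weight :: "(nat \<Rightarrow> 'r) \<Rightarrow> 'r \<Rightarrow> step list \<Rightarrow> 'r::comm_semiring_1" where
  "dyck_weight \<alpha> \<beta> p =
     (\<Prod>i<length p. if p ! i = U then 1 else if i \<in> peak_downs p then \<alpha> i else \<beta>)"

text \<open>The two kinds of a down step of weight \<open>a + b\<close>. The choices are
  extensional functions, so that a path has exactly one choice per assignment of
  kinds to its peaks.\<close>

datatype down_kind = Da | Db

definition split_dyck_paths :: "nat \<Rightarrow> (step list \<times> (nat \<Rightarrow> down_kind)) set" where
  "split_dyck_paths n = (SIGMA p:dyck_paths n. peak_downs p \<rightarrow>\<^sub>E {Da, Db})"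

fun kind_weight :: "'r \<Rightarrow> 'r \<Rightarrow> down_kind \<Rightarrow> 'r" where
  "kind_weight a b Da = a"
| "kind_weight a b Db = b"

fun split_dyck_weight ::
    "'r \<Rightarrow> 'r \<Rightarrow> step list \<times> (nat \<Rightarrow> down_kind) \<Rightarrow> 'r::comm_semiring_1" where
  "split_dyck_weight a b (p, c) = dyck_weight (\<lambda>i. kind_weight a b (c i)) b p"

text \<open>The commuting indeterminates \<open>a\<close> and \<open>b\<close>, as elements of
  \<open>\<int>[a][b]\<close>.\<close>

definition indet_a :: "int poly poly" where "indet_a = [:[:0, 1:]:]"

definition indet_b :: "int poly poly" where "indet_b = [:0, 1:]"

end

theory Submission
  imports Defs
begin

text \<open>
  Both families are encodings of Schroeder paths: trees that are empty, or a flat step followed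
  by a tree, or an arch over a tree followed by a tree, where a flat step weighs \<open>a\<close> and
  an arch weighs \<open>b\<close>.

  For Dyck paths with two kinds of peaks this is the first-return decomposition. A first arch
  with nothing under it and a down step of kind \<open>Da\<close> is read as a flat step; every other
  first arch has a down step of weight \<open>b\<close>, because a nonempty interior leaves no other
  choice and an empty one was given the kind \<open>Db\<close>.

  For G-Motzkin paths a flat step is an \<open>h\<close>-step, and an arch over \<open>s\<close>
  followed by \<open>t\<close> should be written \<open>u s v t\<close>. This has one defect and
  one omission: it creates \<open>uvu\<close> exactly if \<open>s\<close> is empty and \<open>t\<close>
  itself begins with an arch, and it never creates a \<open>d\<close>-step. One trade repairs both: the
  forbidden pattern, an empty arch followed by an arch over \<open>s'\<close> followed by
  \<open>t'\<close>, is written \<open>u s' d t'\<close>. The two arches have weight \<open>b\<^sup>2\<close> and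
  total semilength 2 besides \<open>s'\<close> and \<open>t'\<close>, which is the weight and the
  horizontal length of one \<open>u\<close>-step and one \<open>d\<close>-step. By \<open>sublist_uvu_arch_iff\<close> the resulting
  words are exactly the \<open>uvu\<close>-avoiding ones, and they can be decoded because the first
  return of a path to the axis is unique (\<open>first_return_unique\<close>).
\<close>

section \<open>Excursions\<close>

abbreviation height :: "('a \<Rightarrow> int) \<Rightarrow> 'a list \<Rightarrow> int" where
  "height \<delta> w \<equiv> \<Sum>s\<leftarrow>w. \<delta> s"

text \<open>
  The words that stay weakly above height 0 and end there, given by their decomposition at the
  first return. The alphabet and its heights are left open because the decomposition is needed
  both for lattice steps and for down steps that carry a kind.
\<close>

inductive excursion :: "('a \<Rightarrow> int) \<Rightarrow> 'a list \<Rightarrow> bool" for \<delta> where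
  Nil: "excursion \<delta> []"
| flat: "\<delta> s = 0 \<Longrightarrow> excursion \<delta> w \<Longrightarrow> excursion \<delta> (s # w)"
| arch: "\<delta> s = 1 \<Longrightarrow> excursion \<delta> v \<Longrightarrow> \<delta> t = -1 \<Longrightarrow> excursion \<delta> w \<Longrightarrow>
    excursion \<delta> (s # v @ t # w)"

lemma excursion_height: "excursion \<delta> w \<Longrightarrow> height \<delta> w = 0"
  by (induction rule: excursion.induct) auto

lemma excursion_height_take: "excursion \<delta> w \<Longrightarrow> 0 \<le> height \<delta> (take k w)"
proof (induction arbitrary: k rule: excursion.induct)
  case Nil
  show ?case by simp
next
  case (flat s w)
  then show ?case by (cases k) auto
next
  case (arch s v t w)
  note heights = excursion_height[OF arch.hyps(2)] arch.IH
  show ?case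
  proof (cases k)
    case (Suc i)
    show ?thesis
    proof (cases "i \<le> length v")
      case True
      have "0 \<le> height \<delta> (take i v)" by (rule arch.IH(1))
      with True Suc arch.hyps show ?thesis by simp
    next
      case False
      then obtain j where "i = Suc (length v + j)"
        by (metis add_Suc_right less_imp_Suc_add not_le)
      with Suc heights arch.hyps show ?thesis by (simp add: Suc_diff_le)
    qed
  qed simp
qed

text \<open>
  If the first letter goes up, the rest of the word ends at height -1 relative to its start.
  Heights change by at most one, so the first letter that takes the rest below its start goes
  down by exactly one, and it closes the arch.
\<close>

lemma excursionI:
  assumes unit: "\<And>s. \<delta> s \<in> {-1, 0, 1}"
    and "height \<delta> w = 0" "\<And>k. 0 \<le> height \<delta> (take k w)"
  shows "excursion \<delta> w"
  using assms(2,3)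
proof (induction w rule: length_induct)
  case (1 w)
  show ?case
  proof (cases w)
    case Nil
    then show ?thesis by (simp add: excursion.Nil)
  next
    case (Cons s w')
    have prefixes: "0 \<le> \<delta> s + height \<delta> (take k w')" for k
      using "1.prems"(2)[of "Suc k"] Cons by simp
    have "\<delta> s \<noteq> -1"
      using prefixes[of 0] by simp
    then consider "\<delta> s = 0" | "\<delta> s = 1"
      using unit[of s] by auto
    then show ?thesis
    proof cases
      assume "\<delta> s = 0"
      then have "excursion \<delta> w'"
        using "1.IH" "1.prems"(1) Cons prefixes by auto
      with \<open>\<delta> s = 0\<close> Cons show ?thesis by (simp add: excursion.flat)
    next
      assume up: "\<delta> s = 1"
      \<comment> \<open>Here heights are measured from the end of the first letter.\<close>
      define below where "below k \<longleftrightarrow> height \<delta> (take k w') < 0" for k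
      have "below (length w')"
        using "1.prems"(1) Cons up by (simp add: below_def)
      moreover have "\<not> below 0" by (simp add: below_def)
      ultimately obtain j where j: "j < length w'" "\<And>i. i \<le> j \<Longrightarrow> \<not> below i" "below (Suc j)"
        using ex_least_nat_less[of below "length w'"] by auto
      define v t u where "v = take j w'" and "t = w' ! j" and "u = drop (Suc j) w'"
      have w': "w' = v @ t # u"
        using j(1) by (simp add: v_def t_def u_def id_take_nth_drop)
      have "height \<delta> v + \<delta> t < 0" "0 \<le> height \<delta> v"
        using j by (simp_all add: below_def v_def t_def take_Suc_conv_app_nth not_less)
      then have t: "\<delta> t = -1" and v0: "height \<delta> v = 0"
        using unit[of t] by auto
      have "0 \<le> height \<delta> (take k v)" for k
        using j(2)[of "min k j"] by (simp add: below_def v_def)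
      then have v: "excursion \<delta> v"
        using "1.IH" v0 Cons w' by simp
      have "0 \<le> height \<delta> (take k u)" for k
        using prefixes[of "length v + Suc k"] w' up v0 t by simp
      then have "excursion \<delta> u"
        using "1.IH" "1.prems"(1) v0 Cons w' t up by simp
      with v show ?thesis
        unfolding Cons w' by (intro excursion.arch up t)
    qed
  qed
qed

lemma excursion_iff:
  assumes "\<And>s. \<delta> s \<in> {-1, 0, 1}"
  shows "excursion \<delta> w \<longleftrightarrow>
    height \<delta> w = 0 \<and> (\<forall>k\<le>length w. 0 \<le> height \<delta> (take k w))"
proof (intro iffI conjI allI impI; (elim conjE)?)
  assume "height \<delta> w = 0" and prefixes: "\<forall>k\<le>length w. 0 \<le> height \<delta> (take k w)"
  moreover have "0 \<le> height \<delta> (take k w)" for k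
    using prefixes[rule_format, of k] prefixes[rule_format, of "length w"]
    by (cases "k \<le> length w") auto
  ultimately show "excursion \<delta> w"
    using assms by (intro excursionI)
qed (simp_all add: excursion_height excursion_height_take)

lemma excursion_hd:
  assumes "excursion \<delta> (s # w)"
  shows "0 \<le> \<delta> s"
  using excursion_height_take[OF assms, of 1] by simp

lemma excursion_last:
  assumes "excursion \<delta> (w @ [s])"
  shows "\<delta> s \<le> 0"
  using excursion_height_take[OF assms, of "length w"] excursion_height[OF assms] by simp

lemma excursion_not_extended_down:
  assumes "excursion \<delta> v" "\<delta> t = -1"
  shows "\<not> excursion \<delta> (v @ t # w)"
  using excursion_height_take[of \<delta> "v @ t # w" "Suc (length v)"] excursion_height[OF assms(1)] assms(2)
  by auto

text \<open>
  Were one interior a proper prefix of the other, the longer one would contain the closing letter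
  of the shorter one and so drop below its own start.
\<close>

lemma first_return_unique:
  assumes "v @ t # w = v' @ t' # w'"
    and "excursion \<delta> v" "excursion \<delta> v'" "\<delta> t = -1" "\<delta> t' = -1"
  shows "v = v' \<and> t = t' \<and> w = w'"
proof -
  obtain u where "v = v' @ u \<and> u @ t # w = t' # w' \<or> v @ u = v' \<and> t # w = u @ t' # w'"
    using assms(1) by (auto simp: append_eq_append_conv2)
  then show ?thesis
    using assms(2-) by (cases u) (auto dest: excursion_not_extended_down)
qed

section \<open>Schroeder paths\<close>

datatype schroeder = Empty | Flat schroeder | Arch schroeder schroeder

fun semilength :: "schroeder \<Rightarrow> nat" where
  "semilength Empty = 0"
| "semilength (Flat t) = Suc (semilength t)"
| "semilength (Arch s t) = Suc (semilength s + semilength t)"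

fun schroeder_weight :: "'r \<Rightarrow> 'r \<Rightarrow> schroeder \<Rightarrow> 'r::comm_semiring_1" where
  "schroeder_weight a b Empty = 1"
| "schroeder_weight a b (Flat t) = a * schroeder_weight a b t"
| "schroeder_weight a b (Arch s t) = b * schroeder_weight a b s * schroeder_weight a b t"

section \<open>Schroeder paths as uvu-avoiding G-Motzkin paths\<close>

abbreviation rise :: "step \<Rightarrow> int" where
  "rise s \<equiv> snd (step_vec s)"

lemma rise_unit: "rise s \<in> {-1, 0, 1}"
  by (cases s) auto

lemma endpoint_eq: "endpoint p = (\<Sum>s\<leftarrow>p. fst (step_vec s), height rise p)"
  by (induction p) (auto simp: endpoint_def prod_eq_iff)

lemma g_motzkin_paths_iff:
  "p \<in> g_motzkin_paths n \<longleftrightarrow> excursion rise p \<and> (\<Sum>s\<leftarrow>p. fst (step_vec s)) = int n"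
proof -
  have "0 \<le> fst (step_vec s)" for s
    by (cases s) auto
  then have "0 \<le> (\<Sum>s\<leftarrow>q. fst (step_vec s))" for q
    by (intro sum_list_nonneg) auto
  then show ?thesis
    unfolding g_motzkin_paths_def endpoint_eq excursion_iff[OF rise_unit] by auto
qed

fun motzkin_word :: "schroeder \<Rightarrow> step list" where
  "motzkin_word Empty = []"
| "motzkin_word (Flat t) = H # motzkin_word t"
| "motzkin_word (Arch Empty (Arch s t)) = U # motzkin_word s @ D # motzkin_word t"
| "motzkin_word (Arch s t) = U # motzkin_word s @ V # motzkin_word t"

abbreviation bare_arch_then_arch :: "schroeder \<Rightarrow> schroeder \<Rightarrow> bool" where
  "bare_arch_then_arch s t \<equiv> s = Empty \<and> (\<exists>u v. t = Arch u v)"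

text \<open>
  The overlapping equations of \<open>motzkin_word\<close> are split by constructors. The following rules
  restore the two cases that matter for an arch.
\<close>

lemma motzkin_word_Arch:
  "\<not> bare_arch_then_arch s t \<Longrightarrow> motzkin_word (Arch s t) = U # motzkin_word s @ V # motzkin_word t"
  by (cases s; cases t) auto

lemma motzkin_cases [case_names Empty Flat Down Vertical]:
  assumes "r = Empty \<Longrightarrow> P"
    and "\<And>t. r = Flat t \<Longrightarrow> P"
    and "\<And>s t. r = Arch Empty (Arch s t) \<Longrightarrow> P"
    and "\<And>s t. r = Arch s t \<Longrightarrow> \<not> bare_arch_then_arch s t \<Longrightarrow> P"
  shows P
  using assms by (metis schroeder.exhaust)

lemma motzkin_induct [case_names Empty Flat Down Vertical]:
  assumes "P Empty"
    and "\<And>t. P t \<Longrightarrow> P (Flat t)"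
    and "\<And>s t. P s \<Longrightarrow> P t \<Longrightarrow> P (Arch Empty (Arch s t))"
    and "\<And>s t. \<not> bare_arch_then_arch s t \<Longrightarrow> P s \<Longrightarrow> P t \<Longrightarrow> P (Arch s t)"
  shows "P r"
  by (induction r rule: motzkin_word.induct) (auto intro: assms)

lemma excursion_motzkin_word: "excursion rise (motzkin_word t)"
  by (induction t rule: motzkin_induct) (auto simp: motzkin_word_Arch intro: excursion.intros)

lemma length_motzkin_word: "(\<Sum>s\<leftarrow>motzkin_word t. fst (step_vec s)) = int (semilength t)"
  by (induction t rule: motzkin_induct) (auto simp: motzkin_word_Arch)

lemma weight_motzkin_word:
  "g_motzkin_weight a b (b ^ 2) (motzkin_word t) = schroeder_weight a b t"
  by (induction t rule: motzkin_induct)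
     (simp_all add: motzkin_word_Arch g_motzkin_weight_def power2_eq_square mult_ac)

lemma motzkin_word_eq_Nil_iff: "motzkin_word t = [] \<longleftrightarrow> t = Empty"
  by (cases t rule: motzkin_cases) (auto simp: motzkin_word_Arch)

lemma motzkin_word_starts_up_iff: "(\<exists>w. motzkin_word t = U # w) \<longleftrightarrow> (\<exists>u v. t = Arch u v)"
  by (cases t rule: motzkin_cases) (auto simp: motzkin_word_Arch)

lemma motzkin_word_inject: "motzkin_word r = motzkin_word r' \<Longrightarrow> r = r'"
proof (induction r arbitrary: r' rule: motzkin_induct)
  case Empty
  then show ?case by (metis motzkin_word_eq_Nil_iff)
next
  case (Flat t)
  then show ?case by (cases r' rule: motzkin_cases) (auto simp: motzkin_word_Arch)
next
  case (Down s t)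
  then show ?case
    by (cases r' rule: motzkin_cases)
       (auto simp: motzkin_word_Arch excursion_motzkin_word dest!: first_return_unique[where \<delta> = rise])
next
  case (Vertical s t)
  then show ?case
    by (cases r' rule: motzkin_cases)
       (auto simp: motzkin_word_Arch excursion_motzkin_word dest!: first_return_unique[where \<delta> = rise])
qed

text \<open>
  An excursion neither begins with \<open>V\<close> nor ends with \<open>U\<close>, so an occurrence of
  \<open>uvu\<close> that crosses the boundary of the arch must start with its opening and closing
  letters, with nothing between them.
\<close>

lemma sublist_uvu_arch_iff:
  assumes v: "excursion rise v" and w: "excursion rise w" and x: "rise x = -1"
  shows "sublist [U, V, U] (U # v @ x # w) \<longleftrightarrow>
    sublist [U, V, U] v \<or> sublist [U, V, U] w \<or> x = V \<and> v = [] \<and> (\<exists>u. w = U # u)"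
proof -
  have "\<not> suffix [U] v"
    using v excursion_last[of rise _ U] by (auto simp: suffix_def)
  moreover have "prefix [V, U] (v @ x # w) \<longleftrightarrow> x = V \<and> v = [] \<and> (\<exists>u. w = U # u)"
    using v excursion_hd[of rise V] by (cases v) (auto simp: prefix_def)
  moreover have "x \<noteq> U"
    using x by auto
  ultimately show ?thesis
    by (auto simp: sublist_Cons_right sublist_append Cons_eq_append_conv)
qed

lemma motzkin_word_avoids_uvu: "\<not> sublist [U, V, U] (motzkin_word t)"
  by (induction t rule: motzkin_induct)
     (auto simp: motzkin_word_Arch sublist_uvu_arch_iff excursion_motzkin_word
        motzkin_word_starts_up_iff motzkin_word_eq_Nil_iff sublist_Cons_right[of _ H])

lemma motzkin_word_surj:
  assumes "excursion rise p" "\<not> sublist [U, V, U] p"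
  shows "\<exists>t. p = motzkin_word t"
  using assms
proof (induction rule: excursion.induct)
  case Nil
  show ?case by (metis motzkin_word.simps(1))
next
  case (flat s w)
  have "s = H"
    using flat.hyps(1) by (cases s) auto
  moreover obtain t where "w = motzkin_word t"
    using flat by (auto simp: sublist_Cons_right)
  ultimately show ?case
    by (metis motzkin_word.simps(2))
next
  case (arch s v x w)
  have "s = U"
    using arch.hyps(1) by (cases s) auto
  with arch.prems
  have avoid: "\<not> sublist [U, V, U] v" "\<not> sublist [U, V, U] w" "\<not> (x = V \<and> v = [] \<and> (\<exists>u. w = U # u))"
    by (simp_all add: sublist_uvu_arch_iff arch.hyps)
  with arch.IH obtain q r where "v = motzkin_word q" "w = motzkin_word r" by auto
  note words = \<open>s = U\<close> this
  consider "x = D" | "x = V"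
    using arch.hyps(3) by (cases x) auto
  then show ?case
  proof cases
    assume "x = D"
    then show ?thesis
      unfolding words by (metis motzkin_word.simps(3))
  next
    assume "x = V"
    then have "\<not> bare_arch_then_arch q r"
      using avoid(3) by (simp add: words motzkin_word_starts_up_iff motzkin_word_eq_Nil_iff)
    with \<open>x = V\<close> show ?thesis
      unfolding words by (metis motzkin_word_Arch)
  qed
qed

lemma bij_betw_motzkin_word: "bij_betw motzkin_word {t. semilength t = n} (uvu_avoiding_paths n)"
proof (intro bij_betw_imageI inj_onI)
  show "motzkin_word ` {t. semilength t = n} = uvu_avoiding_paths n"
    by (auto simp: uvu_avoiding_paths_def g_motzkin_paths_iff excursion_motzkin_word
        length_motzkin_word motzkin_word_avoids_uvu dest!: motzkin_word_surj)
qed (auto intro: motzkin_word_inject)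

section \<open>Schroeder paths as Dyck paths with two kinds of peaks\<close>

text \<open>
  A Dyck path with its choice of kinds is written as a single word, in which \<open>None\<close> is an
  up step and \<open>Some k\<close> is a down step of kind \<open>k\<close>. Thus the kinds move along with
  the letters when words are concatenated, and no positions have to be shifted.
\<close>

fun sign :: "down_kind option \<Rightarrow> int" where
  "sign None = 1"
| "sign (Some k) = -1"

lemma sign_unit: "sign x \<in> {-1, 0, 1}"
  by (cases x) auto

text \<open>
  In an excursion the letter before a down step exists, so a down step of kind \<open>Da\<close> lies
  outside every peak iff it follows another down step.
\<close>

abbreviation kinds_at_peaks :: "down_kind option list \<Rightarrow> bool" where
  "kinds_at_peaks w \<equiv> \<forall>k. \<not> sublist [Some k, Some Da] w"

definition dyck_words :: "nat \<Rightarrow> down_kind option list set" where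
  "dyck_words n = {w. excursion sign w \<and> length w = 2 * n \<and> kinds_at_peaks w}"

fun dyck_word :: "schroeder \<Rightarrow> down_kind option list" where
  "dyck_word Empty = []"
| "dyck_word (Flat t) = None # Some Da # dyck_word t"
| "dyck_word (Arch s t) = None # dyck_word s @ Some Db # dyck_word t"

lemma excursion_dyck_word: "excursion sign (dyck_word t)"
proof (induction t)
  case (Flat t)
  then show ?case
    using excursion.arch[of sign None "[]" "Some Da"] by (simp add: excursion.Nil)
qed (auto intro: excursion.intros)

lemma length_dyck_word: "length (dyck_word t) = 2 * semilength t"
  by (induction t) auto

fun letter_weight :: "'r \<Rightarrow> 'r \<Rightarrow> down_kind option \<Rightarrow> 'r::comm_semiring_1" where
  "letter_weight a b None = 1"
| "letter_weight a b (Some k) = kind_weight a b k"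

lemma weight_dyck_word:
  "(\<Prod>x\<leftarrow>dyck_word t. letter_weight a b x) = schroeder_weight a b t"
  by (induction t) (simp_all add: mult_ac)

text \<open>
  Both words begin with an arch, so they are told apart by the kind of the letter at the first return.
\<close>

lemma dyck_word_Flat_neq_Arch: "dyck_word (Flat t) \<noteq> dyck_word (Arch u v)"
  using first_return_unique[of "[]" "Some Da" "dyck_word t" "dyck_word u" "Some Db" "dyck_word v" sign]
  by (auto simp: excursion_dyck_word excursion.Nil)

lemma dyck_word_inject: "dyck_word r = dyck_word r' \<Longrightarrow> r = r'"
proof (induction r arbitrary: r')
  case Empty
  then show ?case by (cases r') auto
next
  case (Flat t)
  then show ?case by (cases r') (use dyck_word_Flat_neq_Arch in auto)
next
  case (Arch s t)
  show ?case
  proof (cases r')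
    case (Flat t')
    then show ?thesis
      using Arch.prems dyck_word_Flat_neq_Arch[of t' s t] by metis
  next
    case r': (Arch s' t')
    then show ?thesis
      using Arch first_return_unique[of "dyck_word s" "Some Db" "dyck_word t" "dyck_word s'" "Some Db" "dyck_word t'" sign]
      by (simp add: excursion_dyck_word)
  qed (use Arch.prems in simp)
qed

lemma sublist_pair_append:
  "sublist [x, y] (v @ w) \<longleftrightarrow> sublist [x, y] v \<or> sublist [x, y] w \<or> suffix [x] v \<and> prefix [y] w"
proof -
  have "sublist [x, y] w" if "prefix [x, y] w"
    using that by (rule prefix_imp_sublist)
  moreover have "sublist [x, y] v" if "suffix [x, y] v"
    using that by (rule suffix_imp_sublist)
  moreover have splits: "[x, y] = us @ vs \<longleftrightarrow> us = [] \<and> vs = [x, y] \<or> us = [x] \<and> vs = [y] \<or> us = [x, y] \<and> vs = []"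
    for us vs
    by (auto simp: Cons_eq_append_conv)
  ultimately show ?thesis
    by (auto simp: sublist_append splits conj_disj_distribR ex_disj_distrib)
qed

text \<open>
  A nonempty excursion ends with a down step, so the closing letter of an arch is in a peak only
  if the arch is empty. The word after the arch begins with no down step, so no pair crosses there.
\<close>

lemma kinds_at_peaks_arch_iff:
  assumes v: "excursion sign v" and w: "excursion sign w"
  shows "kinds_at_peaks (None # v @ Some l # w) \<longleftrightarrow>
    kinds_at_peaks v \<and> kinds_at_peaks w \<and> (l = Da \<longrightarrow> v = [])"
proof -
  have "\<not> prefix [Some k] w" for k
    using w excursion_hd[of sign "Some k"] by (auto simp: prefix_def)
  then have "sublist [Some k, Some Da] (None # v @ Some l # w) \<longleftrightarrow>
      sublist [Some k, Some Da] v \<or> sublist [Some k, Some Da] w \<or> l = Da \<and> suffix [Some k] v" for k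
    by (auto simp: sublist_Cons_right sublist_pair_append)
  moreover have "(\<exists>k. suffix [Some k] v) \<longleftrightarrow> v \<noteq> []"
  proof (cases v rule: rev_cases)
    case (snoc v' y)
    then have "sign y \<le> 0"
      using v excursion_last by metis
    with snoc show ?thesis by (cases y) (auto simp: suffix_def)
  qed simp
  ultimately show ?thesis by blast
qed

lemma dyck_word_kinds_at_peaks: "kinds_at_peaks (dyck_word t)"
proof (induction t)
  case (Flat t)
  then show ?case
    using kinds_at_peaks_arch_iff[of "[]" "dyck_word t" Da]
    by (simp add: excursion_dyck_word excursion.Nil)
qed (auto simp: kinds_at_peaks_arch_iff excursion_dyck_word)

lemma dyck_word_surj:
  assumes "excursion sign w" "kinds_at_peaks w"
  shows "\<exists>t. w = dyck_word t"
  using assms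
proof (induction rule: excursion.induct)
  case Nil
  show ?case by (metis dyck_word.simps(1))
next
  case (flat s w)
  then show ?case by (cases s) auto
next
  case (arch s v x w)
  have "s = None"
    using arch.hyps(1) by (cases s) auto
  moreover obtain l where "x = Some l"
    using arch.hyps(3) by (cases x) auto
  ultimately have peaks: "kinds_at_peaks v" "kinds_at_peaks w" "l = Da \<longrightarrow> v = []"
    using arch.prems kinds_at_peaks_arch_iff[OF arch.hyps(2,4), of l] by simp_all
  with arch.IH obtain q r where "v = dyck_word q" "w = dyck_word r" by auto
  note words = \<open>s = None\<close> \<open>x = Some l\<close> this
  show ?case
  proof (cases l)
    case Da
    with peaks(3) have "s # v @ x # w = dyck_word (Flat r)" by (simp add: words)
    then show ?thesis ..
  next
    case Db
    then have "s # v @ x # w = dyck_word (Arch q r)" by (simp add: words)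
    then show ?thesis ..
  qed
qed

lemma bij_betw_dyck_word: "bij_betw dyck_word {t. semilength t = n} (dyck_words n)"
proof (intro bij_betw_imageI inj_onI)
  show "dyck_word ` {t. semilength t = n} = dyck_words n"
    by (auto simp: dyck_words_def excursion_dyck_word length_dyck_word dyck_word_kinds_at_peaks
        dest!: dyck_word_surj)
qed (auto intro: dyck_word_inject)

section \<open>Reading the choice function off a word\<close>

fun forget_kind :: "down_kind option \<Rightarrow> step" where
  "forget_kind None = U"
| "forget_kind (Some k) = D"

definition split_path :: "down_kind option list \<Rightarrow> step list \<times> (nat \<Rightarrow> down_kind)" where
  "split_path w = (let p = map forget_kind w in (p, \<lambda>i\<in>peak_downs p. the (w ! i)))"

text \<open>
  Down steps outside peaks have no entry in the choice function. They are written with kind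
  \<open>Db\<close>, which gives them their weight \<open>b\<close>.
\<close>

definition split_letter :: "step list \<Rightarrow> (nat \<Rightarrow> down_kind) \<Rightarrow> nat \<Rightarrow> down_kind option" where
  "split_letter p c i =
    (if p ! i = U then None else if i \<in> peak_downs p then Some (c i) else Some Db)"

definition split_word :: "step list \<times> (nat \<Rightarrow> down_kind) \<Rightarrow> down_kind option list" where
  "split_word = (\<lambda>(p, c). map (split_letter p c) [0..<length p])"

lemma rise_forget_kind: "rise (forget_kind x) = sign x" "fst (step_vec (forget_kind x)) = 1"
  by (cases x; simp)+

lemma excursion_forget_kind: "excursion rise (map forget_kind w) \<longleftrightarrow> excursion sign w"
  by (simp add: excursion_iff[OF rise_unit] excursion_iff[OF sign_unit] o_def rise_forget_kind
      flip: take_map)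

lemma forget_kind_dyck_paths:
  "map forget_kind w \<in> dyck_paths n \<longleftrightarrow> excursion sign w \<and> length w = 2 * n"
proof -
  have "forget_kind x \<noteq> H" "forget_kind x \<noteq> V" for x
    by (cases x; simp)+
  then have "H \<notin> set (map forget_kind w)" "V \<notin> set (map forget_kind w)"
    by (simp_all add: image_iff) metis+
  moreover have "(\<Sum>s\<leftarrow>map forget_kind w. fst (step_vec s)) = int (length w)"
    by (simp add: o_def rise_forget_kind sum_list_triv)
  then have "map forget_kind w \<in> g_motzkin_paths (2 * n) \<longleftrightarrow> excursion sign w \<and> length w = 2 * n"
    unfolding g_motzkin_paths_iff excursion_forget_kind by auto
  ultimately show ?thesis
    by (simp add: dyck_paths_def)
qed

text \<open>
  Forgetting the kinds outside peaks loses nothing: a letter \<open>Some Da\<close> follows an up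
  step, hence lies in a peak, so a down step outside all peaks can only be \<open>Some Db\<close>.
\<close>

lemma split_letter_split_path:
  assumes w: "w \<in> dyck_words n" and i: "i < length w"
  shows "split_letter (fst (split_path w)) (snd (split_path w)) i = w ! i"
proof (cases "w ! i")
  case None
  with i show ?thesis by (simp add: split_letter_def split_path_def Let_def)
next
  case (Some k)
  have "i \<in> peak_downs (map forget_kind w)" if "k = Da"
  proof -
    have "i \<noteq> 0"
      using w i Some excursion_hd[of sign "w ! 0" "tl w"]
      by (cases w; cases i) (auto simp: dyck_words_def)
    then obtain j where j: "i = Suc j" by (cases i) auto
    have "w = take j w @ [w ! j, w ! Suc j] @ drop (Suc (Suc j)) w"
      using i j by (simp add: Cons_nth_drop_Suc)
    then have "sublist [w ! j, w ! Suc j] w"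
      by (metis sublist_def)
    then have "w ! j = None"
      using w Some that j by (cases "w ! j") (auto simp: dyck_words_def)
    with i j Some show ?thesis by (auto simp: peak_downs_def)
  qed
  with i Some show ?thesis
    by (cases k) (auto simp: split_letter_def split_path_def Let_def)
qed

lemma split_word_split_path: "w \<in> dyck_words n \<Longrightarrow> split_word (split_path w) = w"
proof (rule nth_equalityI)
  assume w: "w \<in> dyck_words n"
  obtain p c where pc: "split_path w = (p, c)" by fastforce
  then have len: "length p = length w"
    by (auto simp: split_path_def Let_def)
  then show "length (split_word (split_path w)) = length w"
    by (simp add: pc split_word_def)
  then show "split_word (split_path w) ! i = w ! i" if "i < length (split_word (split_path w))" for i
    using that split_letter_split_path[OF w, of i] by (simp add: pc split_word_def)
qed

lemma split_path_split_word:
  assumes "x \<in> split_dyck_paths n"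
  shows "split_path (split_word x) = x" "split_word x \<in> dyck_words n"
proof -
  obtain p c where x: "x = (p, c)" and p: "p \<in> dyck_paths n"
    and c: "c \<in> peak_downs p \<rightarrow>\<^sub>E {Da, Db}"
    using assms by (auto simp: split_dyck_paths_def)
  have word: "split_word x = map (split_letter p c) [0..<length p]"
    by (simp add: x split_word_def)
  have "forget_kind (split_letter p c i) = p ! i" if "i < length p" for i
  proof -
    have "p ! i \<noteq> H" "p ! i \<noteq> V"
      using p that by (auto simp: dyck_paths_def dest: nth_mem)
    then show ?thesis
      by (cases "p ! i") (auto simp: split_letter_def)
  qed
  then have forget: "map forget_kind (split_word x) = p"
    by (intro nth_equalityI) (auto simp: word)
  have "the (split_word x ! i) = c i" if "i \<in> peak_downs p" for i
    using that by (auto simp: word split_letter_def peak_downs_def)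
  then have "(\<lambda>i\<in>peak_downs p. the (split_word x ! i)) = c"
    by (auto simp: PiE_arb[OF c])
  then show "split_path (split_word x) = x"
    unfolding split_path_def forget Let_def by (simp add: x)
  have "kinds_at_peaks (split_word x)"
  proof (intro allI notI)
    fix k assume "sublist [Some k, Some Da] (split_word x)"
    then obtain u v where uv: "split_word x = u @ [Some k, Some Da] @ v"
      by (auto simp: sublist_def)
    let ?j = "length u"
    have "length p = length (split_word x)" by (simp add: word)
    then have len: "Suc ?j < length p" by (simp add: uv)
    have "split_letter p c ?j = Some k" "split_letter p c (Suc ?j) = Some Da"
      using len arg_cong[OF uv, of "\<lambda>w. w ! ?j"] arg_cong[OF uv, of "\<lambda>w. w ! Suc ?j"]
      by (simp_all add: word nth_append)
    then show False
      by (auto simp: split_letter_def peak_downs_def split: if_splits)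
  qed
  moreover have "map forget_kind (split_word x) \<in> dyck_paths n"
    using p forget by simp
  ultimately show "split_word x \<in> dyck_words n"
    unfolding forget_kind_dyck_paths dyck_words_def by blast
qed

lemma bij_betw_split_path: "bij_betw split_path (dyck_words n) (split_dyck_paths n)"
proof (rule bij_betw_byWitness[where f' = split_word])
  have "{Da, Db} = UNIV"
    by (metis UNIV_eq_I down_kind.exhaust insertCI)
  then show "split_path ` dyck_words n \<subseteq> split_dyck_paths n"
    by (auto simp: split_path_def Let_def split_dyck_paths_def dyck_words_def
        forget_kind_dyck_paths)
qed (auto simp: split_word_split_path split_path_split_word)

lemma split_dyck_weight_eq:
  "split_dyck_weight a b (p, c) =
    (\<Prod>i<length p. letter_weight a b (split_letter p c i))"
  by (auto simp: dyck_weight_def split_letter_def intro!: prod.cong)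

lemma weight_split_path:
  assumes "w \<in> dyck_words n"
  shows "split_dyck_weight a b (split_path w) =
    (\<Prod>x\<leftarrow>w. letter_weight a b x)"
proof -
  obtain p c where pc: "split_path w = (p, c)" by fastforce
  have "length p = length w"
    using pc by (auto simp: split_path_def Let_def)
  then have "split_dyck_weight a b (split_path w) =
      (\<Prod>i<length w. letter_weight a b (w ! i))"
    using split_letter_split_path[OF assms] unfolding pc split_dyck_weight_eq
    by (intro prod.cong) auto
  then show ?thesis
    by (simp add: prod.list_conv_set_nth atLeast0LessThan)
qed

theorem corollary2p3:
  fixes n :: nat
  shows "\<exists>f. bij_betw f (uvu_avoiding_paths n) (split_dyck_paths n) \<and>
           (\<forall>p\<in>uvu_avoiding_paths n.
              split_dyck_weight indet_a indet_b (f p)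
                = g_motzkin_weight indet_a indet_b (indet_b ^ 2) p)"
proof -
  define parse where "parse = inv_into {t. semilength t = n} motzkin_word"
  have parse: "bij_betw parse (uvu_avoiding_paths n) {t. semilength t = n}"
    unfolding parse_def by (intro bij_betw_inv_into bij_betw_motzkin_word)
  have "bij_betw (split_path \<circ> dyck_word \<circ> parse) (uvu_avoiding_paths n) (split_dyck_paths n)"
    by (metis parse bij_betw_dyck_word bij_betw_split_path bij_betw_trans)
  moreover have "split_dyck_weight a b ((split_path \<circ> dyck_word \<circ> parse) p) = g_motzkin_weight a b (b ^ 2) p"
    if p: "p \<in> uvu_avoiding_paths n" for p and a b :: "int poly poly"
  proof -
    have "dyck_word (parse p) \<in> dyck_words n"
      using p parse bij_betw_dyck_word by (meson bij_betwE)
    moreover have "motzkin_word (parse p) = p"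
      unfolding parse_def using p bij_betw_motzkin_word by (metis bij_betw_inv_into_right)
    ultimately show ?thesis
      using weight_motzkin_word[of a b "parse p"]
      by (simp add: weight_split_path weight_dyck_word)
  qed
  ultimately show ?thesis by blast
qed

end
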